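(* Let $n\ge 2$ and, for $r,s>0$, let $$p(u,v)=\tfrac12\phi(u)\phi(v-\sqrt{2(r+s)\log n})+\tfrac12\phi(u)\phi(v+\sqrt{2(r+s)\log n}),$$ $$q(u,v)=\tfrac12\phi(u-\sqrt{2r\log n})\phi(v-\sqrt{2s\log n})+\tfrac12\phi(u+\sqrt{2r\log n})\phi(v+\sqrt{2s\log n}).$$ Then $$\sup_{r,s>0}\ \sup_{u,v\in\mathbb{R}}\left|\log\frac{q(u,v)}{p(u,v)}-\sqrt{2\log n}\left(|\sqrt r\,u+\sqrt s\,v|-\sqrt{r+s}\,|v|\right)\right|\le\log 2.$$
   Context: $\phi$ is the density of $N(0,1)$. *)

theory Defs
  imports "HOL-Probability.Probability"
begin

definition p_dens :: "nat \<Rightarrow> real \<Rightarrow> real \<Rightarrow> real \<Rightarrow> real \<Rightarrow> real" where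
  "p_dens n r s u v =
     1 / 2 * std_normal_density u * std_normal_density (v - sqrt (2 * (r + s) * ln (real n)))
   + 1 / 2 * std_normal_density u * std_normal_density (v + sqrt (2 * (r + s) * ln (real n)))"

definition q_dens :: "nat \<Rightarrow> real \<Rightarrow> real \<Rightarrow> real \<Rightarrow> real \<Rightarrow> real" where
  "q_dens n r s u v =
     1 / 2 * std_normal_density (u - sqrt (2 * r * ln (real n)))
           * std_normal_density (v - sqrt (2 * s * ln (real n)))
   + 1 / 2 * std_normal_density (u + sqrt (2 * r * ln (real n)))
           * std_normal_density (v + sqrt (2 * s * ln (real n)))"

end

theory Submission
  imports Defs
begin

text \<open>
  Both densities are equal-weight mixtures of a planar standard Gaussian shifted to two opposite
  points \<open>\<plusminus>(a, b)\<close>. Expanding the squares, such a mixture is the unshifted density times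
  \<open>exp (-(a\<^sup>2 + b\<^sup>2) / 2) * cosh (a * u + b * v)\<close>. The shift points defining \<open>p\<close> and \<open>q\<close> lie at the
  same distance \<open>sqrt (2 * (r + s) * ln n)\<close> from the origin, so everything but the hyperbolic
  cosines cancels in the likelihood ratio. Finally \<open>ln (cosh x)\<close> lies between
  \<open>\<bar>x\<bar> - ln 2\<close> and \<open>\<bar>x\<bar>\<close>, so replacing each log-cosh by an absolute value costs an error in
  the interval from \<open>- ln 2\<close> to \<open>0\<close>. Both errors have the same sign, hence their difference is at
  most \<open>ln 2\<close> in absolute value rather than \<open>2 * ln 2\<close>.
\<close>

lemma symmetric_gaussian_mixture:
  "1 / 2 * std_normal_density (u - a) * std_normal_density (v - b)
     + 1 / 2 * std_normal_density (u + a) * std_normal_density (v + b)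
   = std_normal_density u * std_normal_density v
       * exp (- (a\<^sup>2 + b\<^sup>2) / 2) * cosh (a * u + b * v)"
proof -
  have minus: "std_normal_density (u - a) * std_normal_density (v - b)
      = std_normal_density u * std_normal_density v * exp (- (a\<^sup>2 + b\<^sup>2) / 2) * exp (a * u + b * v)"
    by (simp add: std_normal_density_def flip: exp_add)
       (simp add: power2_eq_square field_simps)
  have plus: "std_normal_density (u + a) * std_normal_density (v + b)
      = std_normal_density u * std_normal_density v * exp (- (a\<^sup>2 + b\<^sup>2) / 2) * exp (- (a * u + b * v))"
    by (simp add: std_normal_density_def flip: exp_add)
       (simp add: power2_eq_square field_simps)
  show ?thesis
    using minus plus by (simp add: cosh_field_def algebra_simps)
qed

text \<open>The larger of the two exponentials in \<open>2 * cosh x = exp x + exp (-x)\<close> is \<open>exp \<bar>x\<bar>\<close>, and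
  the sum lies between one and two copies of it.\<close>

lemma ln_cosh_bounds:
  fixes x :: real
  shows "\<bar>x\<bar> - ln 2 \<le> ln (cosh x)" and "ln (cosh x) \<le> \<bar>x\<bar>"
proof -
  have cosh_abs: "cosh x = (exp \<bar>x\<bar> + exp (- \<bar>x\<bar>)) / 2"
    by (simp add: cosh_field_def abs_if)
  have "exp (\<bar>x\<bar> - ln 2) \<le> cosh x"
    by (simp add: cosh_abs exp_diff)
  then show "\<bar>x\<bar> - ln 2 \<le> ln (cosh x)"
    by (simp add: ln_ge_iff)
  have "exp (- \<bar>x\<bar>) \<le> exp \<bar>x\<bar>"
    by simp
  then have "cosh x \<le> exp \<bar>x\<bar>"
    by (simp add: cosh_abs del: exp_le_cancel_iff)
  then show "ln (cosh x) \<le> \<bar>x\<bar>"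
    by (metis cosh_real_pos ln_exp ln_le_cancel_iff exp_gt_zero)
qed

lemma abs_ln_cosh_ratio_le:
  fixes x y :: real
  shows "\<bar>ln (cosh x / cosh y) - (\<bar>x\<bar> - \<bar>y\<bar>)\<bar> \<le> ln 2"
  using ln_cosh_bounds[of x] ln_cosh_bounds[of y] by (simp add: ln_div)

lemma likelihood_ratio_eq_cosh_ratio:
  assumes "n \<ge> 1" and "r \<ge> 0" and "s \<ge> 0"
  shows "q_dens n r s u v / p_dens n r s u v
    = cosh (sqrt (2 * ln (real n)) * (sqrt r * u + sqrt s * v))
        / cosh (sqrt (2 * ln (real n)) * (sqrt (r + s) * v))"
proof -
  define L where "L = ln (real n)"
  have "L \<ge> 0"
    using assms(1) by (simp add: L_def)
  define C where "C = std_normal_density u * std_normal_density v * exp (- ((r + s) * L))"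
  have "C \<noteq> 0"
    unfolding C_def using normal_density_pos[of 1 0] by (simp add: less_imp_neq[symmetric])
  have "- ((sqrt (2 * r * L))\<^sup>2 + (sqrt (2 * s * L))\<^sup>2) / 2 = - ((r + s) * L)"
    using \<open>L \<ge> 0\<close> assms by (simp add: field_simps)
  moreover have "sqrt (2 * r * L) * u + sqrt (2 * s * L) * v
      = sqrt (2 * L) * (sqrt r * u + sqrt s * v)"
    by (simp add: real_sqrt_mult algebra_simps)
  ultimately have q: "q_dens n r s u v = C * cosh (sqrt (2 * L) * (sqrt r * u + sqrt s * v))"
    by (simp only: q_dens_def symmetric_gaussian_mixture C_def L_def[symmetric])
  \<comment> \<open>The mixture \<open>p\<close> is shifted in the second coordinate only: this is the case \<open>a = 0\<close>.\<close>
  have "- (0\<^sup>2 + (sqrt (2 * (r + s) * L))\<^sup>2) / 2 = - ((r + s) * L)"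
    using \<open>L \<ge> 0\<close> assms by simp
  moreover have "0 * u + sqrt (2 * (r + s) * L) * v = sqrt (2 * L) * (sqrt (r + s) * v)"
    by (simp add: real_sqrt_mult del: distrib_left_numeral)
  ultimately have p: "p_dens n r s u v = C * cosh (sqrt (2 * L) * (sqrt (r + s) * v))"
    using symmetric_gaussian_mixture[of u 0 v "sqrt (2 * (r + s) * L)"]
    by (simp only: p_dens_def C_def L_def[symmetric] diff_zero add_0_right)
  show ?thesis
    using \<open>C \<noteq> 0\<close> by (simp add: p q flip: L_def)
qed

theorem lemma3p1:
  fixes n :: nat
  assumes "n \<ge> 2"
  shows "(SUP (r, s) \<in> {0<..} \<times> {0<..}. SUP (u, v) \<in> UNIV.
            ereal \<bar>ln (q_dens n r s u v / p_dens n r s u v)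
                   - sqrt (2 * ln (real n)) * (\<bar>sqrt r * u + sqrt s * v\<bar> - sqrt (r + s) * \<bar>v\<bar>)\<bar>)
         \<le> ereal (ln 2)"
proof -
  have "\<bar>ln (q_dens n r s u v / p_dens n r s u v)
          - sqrt (2 * ln (real n)) * (\<bar>sqrt r * u + sqrt s * v\<bar> - sqrt (r + s) * \<bar>v\<bar>)\<bar> \<le> ln 2"
    if "r > 0" "s > 0" for r s u v
  proof -
    define x where "x = sqrt (2 * ln (real n)) * (sqrt r * u + sqrt s * v)"
    define y where "y = sqrt (2 * ln (real n)) * (sqrt (r + s) * v)"
    have ratio: "q_dens n r s u v / p_dens n r s u v = cosh x / cosh y"
      unfolding x_def y_def using assms that by (intro likelihood_ratio_eq_cosh_ratio) auto
    have "sqrt (2 * ln (real n)) * (\<bar>sqrt r * u + sqrt s * v\<bar> - sqrt (r + s) * \<bar>v\<bar>) = \<bar>x\<bar> - \<bar>y\<bar>"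
      using assms that by (simp add: x_def y_def abs_mult right_diff_distrib)
    then show ?thesis
      using abs_ln_cosh_ratio_le[of x y] by (simp only: ratio)
  qed
  then show ?thesis
    by (auto intro!: SUP_least)
qed

end
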